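(* Let $\mathfrak{P}$ be an infinite set of primes having a density $\kappa\in(0,1]$ in the sense that $\sum_{p\le X,\,p\in\mathfrak{P}}\frac{\log p}{p}=\kappa\log X+O(1)$ for $X\ge2$. For $y\ge 2$ put $\mathfrak{P}(y)=\prod_{p<y,\,p\in\mathfrak{P}}p$. Let $N$ be large, $2\le z\le D\le\sqrt N$ and $Z\ge z$. Define, for positive integers $m$, $$\rho(m)=\frac{\mathbf{1}_{(m,\mathfrak{P}(z))=1}}{1+\#\{p'\in[z,Z]\cap\mathfrak{P}:\ p'\mid m\}}\in[0,1].$$ Then for any sequence of complex numbers $(u_n)_{1\le n\le N}$ we have $$\sum_{\substack{n\le N\\ (n,\mathfrak{P}(Z))=1}}u_n=\sum_{\substack{d\mid\mathfrak{P}(z)\\ d\le D}}\mu(d)\sum_{\substack{n\le N\\ n\equiv0\ (\mathrm{mod}\ d)}}u_n-\sum_{\substack{mp\le N\\ z\le p<Z,\ p\in\mathfrak{P}}}\rho(m)u_{mp}+\theta E,\qquad |\theta|\le1,$$ where $$E=\sqrt{N\sum_{n\le N}|u_n|^2}\left(\frac{1}{\sqrt z}+\exp\Bigl(\frac{-\log D}{\log z}\Bigr)(\log 3z)^{31}\right).$$ Moreover, if $|u_n|\le1$ for all $n$, the same holds with the first term $\sqrt{N\sum_n|u_n|^2}/\sqrt z$ of $E$ replaced by $N/z$.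
   Context: $\mu$ is the Möbius function; $p,p'$ denote primes. All sums over $n$ run over $1\le n\le N$. *)

theory Defs
  imports Complex_Main "HOL-Computational_Algebra.Squarefree"
begin

definition moebius_mu :: "nat \<Rightarrow> int" where
  "moebius_mu n = (if squarefree n then (-1) ^ card (prime_factors n) else 0)"

definition has_log_density :: "nat set \<Rightarrow> real \<Rightarrow> bool" where
  "has_log_density P \<kappa> \<longleftrightarrow>
     (\<exists>C. \<forall>X::real. 2 \<le> X \<longrightarrow>
        \<bar>(\<Sum>p | p \<in> P \<and> real p \<le> X. ln (real p) / real p) - \<kappa> * ln X\<bar> \<le> C)"

definition prime_prod :: "nat set \<Rightarrow> real \<Rightarrow> nat" where
  "prime_prod P y = (\<Prod>p | p \<in> P \<and> real p < y. p)"

(* The primes p' are counted on the closed interval [z, Z]. *)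
definition rho :: "nat set \<Rightarrow> real \<Rightarrow> real \<Rightarrow> nat \<Rightarrow> real" where
  "rho P z Z m =
     (if coprime m (prime_prod P z) then 1 else 0) /
     (1 + real (card {p' \<in> P. z \<le> real p' \<and> real p' \<le> Z \<and> p' dvd m}))"

lemma rho_range: "rho P z Z m \<in> {0..1}"
  by (simp add: rho_def)

end

theory Submission
  imports Defs "HOL-Analysis.L2_Norm" "HOL-Analysis.Infinite_Products"
begin

text \<open>
  Weighting \<open>u n\<close> by 1 on the \<open>n\<close> coprime to \<open>\<PP>(Z)\<close> differs from weighting it by the two main terms by
  \<open>u n * (e n - c n)\<close>, where \<open>e n\<close> is the error of truncating the Legendre sieve for \<open>\<PP>(z)\<close> at level
  \<open>D\<close>, and \<open>c n\<close> measures how far the weights \<open>\<rho>(n/p)\<close> are from summing to 1 over the primes \<open>p\<close> in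
  \<open>[z, Z)\<close> dividing a sifted \<open>n\<close>.

  Both \<open>d \<mapsto> \<mu>(d)\<close> and \<open>d \<mapsto> d\<^sup>s\<close> are products over the prime factors of a squarefree \<open>d\<close>, so Rankin's
  trick with exponent \<open>s = 1 / log z\<close> gives \<open>|e n| \<le> exp (- log D / log z) * 4\<^sup>\<omega>\<close>, where \<open>\<omega>\<close> counts the
  sieving primes dividing \<open>n\<close> and \<open>4 > 1 + exp 1\<close>. As \<open>4\<^sup>2 = 1 + 15\<close>, the mean square of \<open>4\<^sup>\<omega>\<close> is at most
  the product of \<open>1 + 15 / p\<close>, which is at most \<open>(log 3z)\<^sup>6\<^sup>0\<close> since the sum of \<open>1 / p\<close> over \<open>p \<le> z\<close> is
  at most \<open>4 log log 3z\<close>.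

  Finally \<open>0 \<le> c n \<le> 1\<close>, and \<open>c n\<close> vanishes unless \<open>n\<close> is divisible by \<open>p\<^sup>2\<close> for some \<open>p \<ge> z\<close>, or by both
  the prime \<open>Z\<close> and a smaller one in \<open>[z, Z)\<close>: the count in \<open>\<rho>\<close> includes \<open>p' = Z\<close>, the sum over \<open>p\<close>
  does not. Hence the \<open>c n\<close> sum to at most \<open>N / z\<close>. The Cauchy-Schwarz inequality combines both errors with \<open>u\<close>.
\<close>

section \<open>Squarefree numbers and the truncated Legendre sieve\<close>

lemma prod_prime_factors_squarefree:
  fixes n :: "'a :: factorial_semiring_multiplicative"
  assumes "squarefree n"
  shows "\<Prod>(prime_factors n) = normalize n"
proof -
  have "n \<noteq> 0" using assms by auto
  then have "\<Prod>(prime_factors n) = (\<Prod>p\<in>prime_factors n. p ^ multiplicity p n)"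
    using assms by (intro prod.cong refl) (simp add: squarefree_factorial_semiring')
  then show ?thesis using prod_prime_factors[OF \<open>n \<noteq> 0\<close>] by simp
qed

lemma of_nat_eq_prod_prime_factors:
  assumes "squarefree n"
  shows "of_nat n = (\<Prod>p\<in>prime_factors n. of_nat p :: 'a :: comm_semiring_1)"
proof -
  have "of_nat n = (of_nat (\<Prod>(prime_factors n)) :: 'a)"
    by (simp only: prod_prime_factors_squarefree[OF assms] normalize_nat_def id_apply)
  then show ?thesis by (simp only: of_nat_prod)
qed

lemma squarefree_imp_pos_nat: "squarefree (n::nat) \<Longrightarrow> 0 < n"
  by (rule gr0I) simp

lemma finite_divisors_squarefree: "squarefree (n::nat) \<Longrightarrow> finite {d. d dvd n}"
  by (simp add: squarefree_imp_pos_nat)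

lemma squarefree_prod_primes:
  fixes A :: "nat set"
  assumes "\<And>p. p \<in> A \<Longrightarrow> prime p"
  shows "squarefree (\<Prod>A)"
  using assms by (intro squarefree_prod_coprime) (auto intro: primes_coprime squarefree_prime)

lemma prime_factors_prod_primes:
  fixes A :: "nat set"
  assumes "finite A" "\<And>p. p \<in> A \<Longrightarrow> prime p"
  shows "prime_factors (\<Prod>A) = A"
proof -
  have "0 \<notin> A" using assms(2)[of 0] by auto
  then have "prime_factors (\<Prod>A) = (\<Union>p\<in>A. prime_factors p)"
    using prime_factors_prod[of A "\<lambda>p. p"] assms(1) by simp
  also have "\<dots> = (\<Union>p\<in>A. {p})"
    using assms(2) by (intro SUP_cong refl) (simp add: prime_prime_factors)
  finally show ?thesis by simp
qed

lemma sum_divisors_squarefree: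
  fixes q :: nat and g :: "nat \<Rightarrow> 'a :: comm_semiring_1"
  assumes q: "squarefree q"
  shows "(\<Sum>d | d dvd q. \<Prod>p\<in>prime_factors d. g p) = (\<Prod>p\<in>prime_factors q. 1 + g p)"
proof -
  have "(\<Prod>p\<in>prime_factors q. g p + 1) = (\<Sum>B\<in>Pow (prime_factors q). \<Prod>p\<in>B. g p)"
    by (subst prod_add) auto
  also have "\<dots> = (\<Sum>d | d dvd q. \<Prod>p\<in>prime_factors d. g p)"
  proof (rule sum.reindex_bij_witness[where i = prime_factors and j = "\<lambda>B. \<Prod>B"])
    fix B assume B: "B \<in> Pow (prime_factors q)"
    then have "finite B" using finite_set_mset finite_subset by blast
    then show factors: "prime_factors (\<Prod>B) = B"
      using B by (intro prime_factors_prod_primes) auto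
    have "\<Prod>B dvd \<Prod>(prime_factors q)" using B by (intro prod_dvd_prod_subset) auto
    then show "\<Prod>B \<in> {d. d dvd q}" by (simp add: prod_prime_factors_squarefree[OF q])
    show "prod g (prime_factors (\<Prod>B)) = prod g B" by (simp only: factors)
  next
    fix d assume "d \<in> {d. d dvd q}"
    then have d: "d dvd q" by simp
    then show "\<Prod>(prime_factors d) = d"
      using prod_prime_factors_squarefree[of d] squarefree_mono[OF d q] by simp
    show "prime_factors d \<in> Pow (prime_factors q)"
      using dvd_prime_factors[OF _ d] squarefree_imp_pos_nat[OF q] by simp
  qed
  finally show ?thesis by (simp add: add.commute)
qed

lemma moebius_mu_squarefree:
  "squarefree n \<Longrightarrow> moebius_mu n = (\<Prod>p\<in>prime_factors n. -1)"
  by (simp add: moebius_mu_def)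

lemma abs_moebius_mu_le_1: "\<bar>moebius_mu n\<bar> \<le> 1"
  by (simp add: moebius_mu_def)

lemma sum_moebius_mu_divisors:
  assumes "squarefree q"
  shows "(\<Sum>d | d dvd q. moebius_mu d) = of_bool (q = 1)"
proof -
  have "(\<Sum>d | d dvd q. moebius_mu d) = (\<Sum>d | d dvd q. \<Prod>p\<in>prime_factors d. -1)"
    using assms by (intro sum.cong refl moebius_mu_squarefree) (simp add: squarefree_mono[OF _ assms])
  also have "\<dots> = (\<Prod>p\<in>prime_factors q. 1 + -1)"
    by (rule sum_divisors_squarefree[OF assms])
  also have "\<dots> = of_bool (q = 1)"
    using squarefree_imp_pos_nat[OF assms] by (auto simp: card_gt_0_iff prime_factorization_empty_iff)
  finally show ?thesis .
qed

definition legendre_error :: "real \<Rightarrow> nat \<Rightarrow> real" where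
  "legendre_error D q =
     of_bool (q = 1) - (\<Sum>d | d dvd q \<and> real d \<le> D. real_of_int (moebius_mu d))"

lemma legendre_error_eq_tail:
  assumes q: "squarefree q"
  shows "legendre_error D q = (\<Sum>d | d dvd q \<and> D < real d. real_of_int (moebius_mu d))"
proof -
  have "of_bool (q = 1) = real_of_int (\<Sum>d | d dvd q. moebius_mu d)"
    by (simp add: sum_moebius_mu_divisors[OF q])
  also have "\<dots> = (\<Sum>d \<in> {d. d dvd q \<and> real d \<le> D} \<union> {d. d dvd q \<and> D < real d}. real_of_int (moebius_mu d))"
    by (simp only: of_int_sum) (rule sum.cong, auto)
  also have "\<dots> = (\<Sum>d | d dvd q \<and> real d \<le> D. real_of_int (moebius_mu d))
      + (\<Sum>d | d dvd q \<and> D < real d. real_of_int (moebius_mu d))"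
    using finite_divisors_squarefree[OF q] by (intro sum.union_disjoint) auto
  finally show ?thesis by (simp add: legendre_error_def)
qed

text \<open>Rankin's trick: \<open>1 \<le> (d / D) powr s\<close> on the tail \<open>d > D\<close>.\<close>

lemma abs_legendre_error_le:
  assumes q: "squarefree q" and D: "0 < D" and s: "0 \<le> s"
  shows "\<bar>legendre_error D q\<bar> \<le> D powr (-s) * (\<Prod>p\<in>prime_factors q. 1 + real p powr s)"
proof -
  have "\<bar>legendre_error D q\<bar> \<le> (\<Sum>d | d dvd q \<and> D < real d. 1)"
    unfolding legendre_error_eq_tail[OF q]
    by (rule order_trans[OF sum_abs]) (intro sum_mono, simp add: abs_moebius_mu_le_1 flip: of_int_abs)
  also have "\<dots> \<le> (\<Sum>d | d dvd q \<and> D < real d. D powr (-s) * real d powr s)"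
  proof (rule sum_mono)
    fix d assume "d \<in> {d. d dvd q \<and> D < real d}"
    then have "1 \<le> (real d / D) powr s" using D s by (intro ge_one_powr_ge_zero) auto
    also have "\<dots> = D powr (-s) * real d powr s"
      using D by (simp add: powr_divide powr_minus_divide)
    finally show "1 \<le> D powr (-s) * real d powr s" .
  qed
  also have "\<dots> \<le> (\<Sum>d | d dvd q. D powr (-s) * real d powr s)"
    using finite_divisors_squarefree[OF q] by (intro sum_mono2) auto
  also have "\<dots> = D powr (-s) * (\<Sum>d | d dvd q. \<Prod>p\<in>prime_factors d. real p powr s)"
    unfolding sum_distrib_left
  proof (intro sum.cong refl arg_cong2[where f = "(*)"])
    fix d assume "d \<in> {d. d dvd q}"
    then have "real d = (\<Prod>p\<in>prime_factors d. real p)"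
      by (intro of_nat_eq_prod_prime_factors) (simp add: squarefree_mono[OF _ q])
    then show "real d powr s = (\<Prod>p\<in>prime_factors d. real p powr s)"
      by (simp add: prod_powr_distrib)
  qed
  also have "\<dots> = D powr (-s) * (\<Prod>p\<in>prime_factors q. 1 + real p powr s)"
    by (simp only: sum_divisors_squarefree[OF q])
  finally show ?thesis .
qed

lemma abs_legendre_error_le_power_card:
  assumes q: "squarefree q" and z: "1 < z" "\<And>p. p \<in> prime_factors q \<Longrightarrow> real p \<le> z" and D: "0 < D"
  shows "\<bar>legendre_error D q\<bar> \<le> exp (- ln D / ln z) * 4 ^ card (prime_factors q)"
proof -
  have powr_le_3: "real p powr (1 / ln z) \<le> 3" if "p \<in> prime_factors q" for p
  proof -
    have "real p powr (1 / ln z) \<le> z powr (1 / ln z)"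
      using z that by (intro powr_mono2) auto
    also have "\<dots> = exp 1" using z(1) by (simp add: powr_def)
    finally show ?thesis using exp_le by simp
  qed
  have "\<bar>legendre_error D q\<bar>
      \<le> D powr (- (1 / ln z)) * (\<Prod>p\<in>prime_factors q. 1 + real p powr (1 / ln z))"
    using z(1) by (intro abs_legendre_error_le q D) simp
  also have "\<dots> \<le> D powr (- (1 / ln z)) * (\<Prod>p\<in>prime_factors q. 4)"
    using powr_le_3 by (intro mult_left_mono prod_mono) (force intro: add_nonneg_nonneg)+
  also have "\<dots> = exp (- ln D / ln z) * 4 ^ card (prime_factors q)" using D by (simp add: powr_def)
  finally show ?thesis .
qed

section \<open>Sums over multiples\<close>

lemma card_multiples: "card {n \<in> {1..N}. d dvd n} = N div d"
proof (cases "d = 0")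
  case False
  have "bij_betw (\<lambda>k. d * k) {1..N div d} {n \<in> {1..N}. d dvd n}"
  proof (rule bij_betw_byWitness[where f' = "\<lambda>n. n div d"])
    show "(\<lambda>n. n div d) ` {n \<in> {1..N}. d dvd n} \<subseteq> {1..N div d}"
      using False by (auto simp: less_eq_div_iff_mult_less_eq mult.commute elim!: dvdE)
  qed (use False in \<open>auto simp: Suc_le_eq less_eq_div_iff_mult_less_eq mult.commute\<close>)
  then show ?thesis using bij_betw_same_card by fastforce
qed auto

lemma card_multiples_le: "real (card {n \<in> {1..N}. d dvd n}) \<le> real N / real d"
  unfolding card_multiples by (rule of_nat_div_le_of_nat)

lemma sum_inverse_squares_le:
  assumes "1 \<le> a"
  shows "(\<Sum>k=a..N. 1 / (real k)\<^sup>2) \<le> 1 / (real a - 1 / 2)"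
proof (cases "a \<le> N")
  case True
  let ?f = "\<lambda>k. - 1 / (real k - 1 / 2)"
  have "(\<Sum>k=a..N. 1 / (real k)\<^sup>2) \<le> (\<Sum>k=a..N. ?f (Suc k) - ?f k)"
  proof (rule sum_mono)
    fix k assume "k \<in> {a..N}"
    then have k: "1 \<le> real k" using assms by simp
    then have "0 < (real k)\<^sup>2 - 1 / 4" using one_le_power[of "real k" 2] by linarith
    then have "1 / (real k)\<^sup>2 \<le> 1 / ((real k)\<^sup>2 - 1 / 4)" by (intro frac_le) auto
    also have "\<dots> = ?f (Suc k) - ?f k"
      using k by (simp add: field_simps power2_eq_square)
    finally show "1 / (real k)\<^sup>2 \<le> ?f (Suc k) - ?f k" .
  qed
  also have "\<dots> = ?f (Suc N) - ?f a" using True by (intro sum_Suc_diff) simp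
  also have "\<dots> \<le> 1 / (real a - 1 / 2)" by simp
  finally show ?thesis .
qed (use assms in simp)

lemma sum_of_bool_dvd_le: "(\<Sum>n=1..N. of_bool (d dvd n)) \<le> real N / real d"
  using card_multiples_le[of N d] by (simp add: Int_def)

lemma sum_of_bool_square_dvd_le:
  assumes "1 \<le> a"
  shows "(\<Sum>k=a..M. \<Sum>n=1..N. of_bool (k\<^sup>2 dvd n)) \<le> real N / (real a - 1 / 2)"
proof -
  have "(\<Sum>k=a..M. \<Sum>n=1..N. of_bool (k\<^sup>2 dvd n)) \<le> (\<Sum>k=a..M. real N / real (k\<^sup>2))"
    by (intro sum_mono sum_of_bool_dvd_le)
  also have "\<dots> = real N * (\<Sum>k=a..M. 1 / (real k)\<^sup>2)" by (simp add: sum_distrib_left)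
  also have "\<dots> \<le> real N * (1 / (real a - 1 / 2))"
    by (intro mult_left_mono sum_inverse_squares_le assms) simp
  finally show ?thesis by simp
qed

lemma sum_prod_prime_factors_gcd_le:
  fixes g :: "nat \<Rightarrow> real"
  assumes q: "squarefree q" and g: "\<And>p. p \<in> prime_factors q \<Longrightarrow> 0 \<le> g p"
  shows "(\<Sum>n=1..N. \<Prod>p\<in>prime_factors (gcd n q). 1 + g p)
         \<le> real N * (\<Prod>p\<in>prime_factors q. 1 + g p / real p)"
proof -
  let ?h = "\<lambda>d. \<Prod>p\<in>prime_factors d. g p"
  have h_nonneg: "0 \<le> ?h d" if "d dvd q" for d
    using g dvd_prime_factors[OF _ that] squarefree_imp_pos_nat[OF q] by (intro prod_nonneg) auto
  have "(\<Prod>p\<in>prime_factors (gcd n q). 1 + g p) = (\<Sum>d \<in> {d \<in> {d. d dvd q}. d dvd n}. ?h d)" for n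
  proof -
    have "squarefree (gcd n q)" by (rule squarefree_mono[OF gcd_dvd2 q])
    then show ?thesis by (simp add: conj_commute flip: sum_divisors_squarefree)
  qed
  then have "(\<Sum>n=1..N. \<Prod>p\<in>prime_factors (gcd n q). 1 + g p)
      = (\<Sum>n\<in>{1..N}. \<Sum>d \<in> {d \<in> {d. d dvd q}. d dvd n}. ?h d)" by simp
  also have "\<dots> = (\<Sum>d | d dvd q. \<Sum>n \<in> {n \<in> {1..N}. d dvd n}. ?h d)"
    using finite_divisors_squarefree[OF q] by (intro sum.swap_restrict) auto
  also have "\<dots> \<le> (\<Sum>d | d dvd q. real N / real d * ?h d)"
    unfolding sum_constant
    using h_nonneg by (intro sum_mono mult_right_mono card_multiples_le) auto
  also have "\<dots> = real N * (\<Sum>d | d dvd q. \<Prod>p\<in>prime_factors d. g p / real p)"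
    unfolding sum_distrib_left
  proof (intro sum.cong refl)
    fix d assume "d \<in> {d. d dvd q}"
    then have "real d = (\<Prod>p\<in>prime_factors d. real p)"
      by (intro of_nat_eq_prod_prime_factors) (simp add: squarefree_mono[OF _ q])
    then show "real N / real d * ?h d = real N * (\<Prod>p\<in>prime_factors d. g p / real p)"
      by (simp add: prod_dividef)
  qed
  also have "\<dots> = real N * (\<Prod>p\<in>prime_factors q. 1 + g p / real p)"
    by (simp only: sum_divisors_squarefree[OF q])
  finally show ?thesis .
qed

lemma sum_moebius_multiples:
  fixes u :: "nat \<Rightarrow> 'a :: real_normed_field"
  assumes q: "squarefree q"
  shows "(\<Sum>d | d dvd q \<and> real d \<le> D. of_int (moebius_mu d) * (\<Sum>n | n \<in> {1..N} \<and> d dvd n. u n))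
    = (\<Sum>n=1..N. u n * of_real (of_bool (coprime n q) - legendre_error D (gcd n q)))"
proof -
  have "(\<Sum>d | d dvd q \<and> real d \<le> D. of_int (moebius_mu d) * (\<Sum>n | n \<in> {1..N} \<and> d dvd n. u n))
      = (\<Sum>d | d dvd q \<and> real d \<le> D. \<Sum>n | n \<in> {1..N} \<and> d dvd n. u n * of_int (moebius_mu d))"
    by (simp add: sum_distrib_left mult.commute)
  also have "\<dots> = (\<Sum>n=1..N. \<Sum>d | d \<in> {d. d dvd q \<and> real d \<le> D} \<and> d dvd n. u n * of_int (moebius_mu d))"
    using finite_divisors_squarefree[OF q] by (intro sum.swap_restrict) auto
  also have "\<dots> = (\<Sum>n=1..N. u n * of_real (\<Sum>d | d dvd gcd n q \<and> real d \<le> D. of_int (moebius_mu d)))"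
    unfolding of_real_sum sum_distrib_left
    by (intro sum.cong) auto
  also have "\<dots> = (\<Sum>n=1..N. u n * of_real (of_bool (coprime n q) - legendre_error D (gcd n q)))"
    by (simp add: legendre_error_def coprime_iff_gcd_eq_1)
  finally show ?thesis .
qed

lemma sum_pairs_mult_le:
  fixes F :: "nat \<Rightarrow> nat \<Rightarrow> 'a :: comm_monoid_add"
  assumes Q: "0 \<notin> Q"
  shows "(\<Sum>(m, p) | 1 \<le> m \<and> p \<in> Q \<and> m * p \<le> N. F m p)
    = (\<Sum>n=1..N. \<Sum>p | p \<in> Q \<and> p dvd n. F (n div p) p)"
proof -
  let ?S = "Sigma {1..N} (\<lambda>n. {p. p \<in> Q \<and> p dvd n})" and ?T = "{(m, p). 1 \<le> m \<and> p \<in> Q \<and> m * p \<le> N}"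
  have pos: "0 < p" if "p \<in> Q" for p using Q that by (cases p) auto
  have "(\<Sum>n=1..N. \<Sum>p | p \<in> Q \<and> p dvd n. F (n div p) p) = (\<Sum>(n, p)\<in>?S. F (n div p) p)"
    by (intro sum.Sigma) (auto intro: finite_subset[of _ "{d. d dvd _}"])
  also have "\<dots> = (\<Sum>(m, p)\<in>?T. F m p)"
  proof (rule sum.reindex_bij_witness[where i = "\<lambda>(m, p). (m * p, p)" and j = "\<lambda>(n, p). (n div p, p)"])
    fix x assume "x \<in> ?S"
    then obtain n p where x: "x = (n, p)" "1 \<le> n" "n \<le> N" "p \<in> Q" "p dvd n" by auto
    then have "1 \<le> n div p" using pos[of p] by (auto simp: div_greater_zero_iff Suc_le_eq dest: dvd_imp_le)
    then show "(case x of (n, p) \<Rightarrow> (n div p, p)) \<in> ?T" using x by auto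
  qed (use pos in \<open>auto simp: Suc_le_eq\<close>)
  finally show ?thesis by simp
qed

section \<open>Reciprocals of primes\<close>

lemma prod_primes_between_double_le: "\<Prod>{p. prime p \<and> n < p \<and> p \<le> 2 * n} \<le> (4::nat) ^ n"
proof -
  let ?B = "{p. prime p \<and> n < p \<and> p \<le> 2 * n}" and ?C = "(2 * n) choose n"
  have dvd: "p dvd ?C" if p: "p \<in> ?B" for p
  proof -
    have "p dvd fact (2 * n)" using p by (simp add: prime_dvd_fact_iff)
    also have "(fact (2 * n) :: nat) = fact n * fact n * ?C"
      using binomial_fact_lemma[of n "2 * n"] by (simp add: mult_2)
    finally have "p dvd fact n * fact n * ?C" .
    moreover have "\<not> p dvd fact n" using p by (simp add: prime_dvd_fact_iff)
    ultimately show ?thesis using p by (auto simp: prime_dvd_mult_iff)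
  qed
  have "?B \<subseteq> prime_factors ?C" using dvd by (auto simp: in_prime_factors_iff)
  then have "\<Prod>?B dvd \<Prod>(prime_factors ?C)" by (intro prod_dvd_prod_subset) auto
  also have "\<dots> dvd (\<Prod>p\<in>prime_factors ?C. p ^ multiplicity p ?C)"
    by (intro prod_dvd_prod) (auto simp: prime_factors_multiplicity intro: dvd_power)
  also have "\<dots> = ?C" by (subst prod_prime_factors) auto
  finally have "\<Prod>?B \<le> ?C" by (rule dvd_imp_le) simp
  also have "\<dots> \<le> 2 ^ (2 * n)" by (rule binomial_le_pow2)
  finally show ?thesis by (simp add: power_mult)
qed

lemma sum_inverse_primes_between_double_le:
  assumes n: "2 \<le> n"
  shows "(\<Sum>p | prime p \<and> n < p \<and> p \<le> 2 * n. 1 / real p) \<le> ln 4 / ln (real n)"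
proof -
  let ?B = "{p. prime p \<and> n < p \<and> p \<le> 2 * n}"
  have "n ^ card ?B = (\<Prod>p\<in>?B. n)" by simp
  also have "\<dots> \<le> \<Prod>?B" by (intro prod_mono) auto
  finally have "n ^ card ?B \<le> 4 ^ n" using prod_primes_between_double_le[of n] by linarith
  then have "real (n ^ card ?B) \<le> real (4 ^ n)" by (simp only: of_nat_le_iff)
  then have "real n ^ card ?B \<le> 4 ^ n" by simp
  then have "ln (real n ^ card ?B) \<le> ln (4 ^ n)" using n by (subst ln_le_cancel_iff) auto
  then have "real (card ?B) * ln (real n) \<le> real n * ln 4" using n by (simp add: ln_realpow)
  then have "real (card ?B) / real n \<le> ln 4 / ln (real n)"
    using n by (simp add: divide_le_eq le_divide_eq mult.commute)
  moreover have "(\<Sum>p\<in>?B. 1 / real p) \<le> (\<Sum>p\<in>?B. 1 / real n)"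
    using n by (intro sum_mono frac_le) auto
  ultimately show ?thesis by simp
qed

lemma ln_4_div_ln_le:
  fixes x :: real
  assumes x: "2 \<le> x"
  shows "ln 4 / ln (2 * x) \<le> 4 * (ln (ln (3 * (2 * x))) - ln (ln (3 * x)))"
proof -
  define L M where "L = ln (3 * x)" and "M = ln (3 * (2 * x))"
  have L: "0 < L" and M: "0 < M" using x by (simp_all add: L_def M_def)
  have M_eq: "M = L + ln 2" using x ln_mult[of 2 "3 * x"] by (simp add: L_def M_def)
  have "3 * (2 * x) \<le> (2 * x)\<^sup>2" using x by (simp add: power2_eq_square)
  then have "M \<le> ln ((2 * x)\<^sup>2)" unfolding M_def using x by (intro ln_mono) auto
  also have "\<dots> = 2 * ln (2 * x)" using x by (subst ln_realpow) auto
  finally have "ln 4 / ln (2 * x) \<le> ln 4 / (M / 2)"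
    using M x by (intro divide_left_mono mult_pos_pos) auto
  also have "\<dots> = 4 * (1 - L / M)"
    using M ln_realpow[of 2 2] M_eq by (simp add: field_simps)
  also have "1 - L / M \<le> ln M - ln L"
    using ln_le_minus_one[of "L / M"] L M by (simp add: ln_div)
  finally show ?thesis by (simp add: L_def M_def)
qed

lemma finite_primes_le: "finite {p::nat. prime p \<and> p \<le> n}"
  by (rule finite_subset[of _ "{..n}"]) auto

lemma primes_le_4: "{p::nat. prime p \<and> p \<le> 4} = {2, 3}"
proof (intro equalityI subsetI)
  fix p :: nat assume "p \<in> {p. prime p \<and> p \<le> 4}"
  moreover have "\<not> prime (4::nat)" using prime_product[of 2 "2::nat"] by auto
  ultimately have "p \<noteq> 4" "2 \<le> p" "p \<le> 4" by (auto dest: prime_ge_2_nat)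
  then show "p \<in> {2, 3}" by auto
qed auto

lemma sum_inverse_primes_power_of_2_le:
  assumes "1 \<le> j"
  shows "(\<Sum>p | prime p \<and> p \<le> 2 ^ Suc j. 1 / real p) \<le> 4 * ln (ln (3 * 2 ^ j))"
  using assms
proof (induction j rule: dec_induct)
  case base
  have "(\<Sum>p | prime p \<and> p \<le> 2 ^ Suc 1. 1 / real p) = 5 / 6" by (simp add: primes_le_4)
  also have "5 / 6 \<le> 4 * ln (3 / 2 :: real)"
    using ln_le_minus_one[of "2 / 3"] by (simp add: ln_div)
  also have "\<dots> \<le> 4 * ln (ln (3 * 2 ^ 1))"
  proof (intro mult_left_mono ln_mono)
    have "1 \<le> ln (3::real)" using exp_le by (simp add: ln_ge_iff)
    moreover have "1 / 2 \<le> ln (2::real)" using ln_le_minus_one[of "1 / 2"] by (simp add: ln_div)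
    ultimately show "3 / 2 \<le> ln (3 * 2 ^ 1 :: real)" using ln_mult[of 3 "2::real"] by simp
  qed auto
  finally show ?case .
next
  case (step j)
  have "{p::nat. prime p \<and> p \<le> 2 ^ Suc (Suc j)}
      = {p. prime p \<and> p \<le> 2 ^ Suc j} \<union> {p. prime p \<and> 2 ^ Suc j < p \<and> p \<le> 2 * 2 ^ Suc j}"
    by auto
  then have "(\<Sum>p | prime p \<and> p \<le> 2 ^ Suc (Suc j). 1 / real p)
      = (\<Sum>p | prime p \<and> p \<le> 2 ^ Suc j. 1 / real p)
        + (\<Sum>p | prime p \<and> 2 ^ Suc j < p \<and> p \<le> 2 * 2 ^ Suc j. 1 / real p)"
    by (simp only:) (intro sum.union_disjoint,
        auto intro: finite_subset[OF _ finite_primes_le[of "2 * 2 ^ Suc j"]])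
  also have "\<dots> \<le> 4 * ln (ln (3 * 2 ^ j)) + ln 4 / ln (real (2 ^ Suc j))"
    using step.IH by (intro add_mono sum_inverse_primes_between_double_le) auto
  also have "real (2 ^ Suc j) = 2 * 2 ^ j" by simp
  also have "ln 4 / ln (2 * 2 ^ j) \<le> 4 * (ln (ln (3 * (2 * 2 ^ j))) - ln (ln (3 * 2 ^ j :: real)))"
    using power_increasing[OF step.hyps(1), of "2::real"] by (intro ln_4_div_ln_le) simp
  finally show ?case by simp
qed

lemma finite_primes_real_le: "finite {p::nat. prime p \<and> real p \<le> z}"
  by (rule finite_subset[OF _ finite_primes_le[of "nat \<lfloor>z\<rfloor>"]]) (auto simp: le_nat_floor)

lemma sum_inverse_primes_le:
  fixes z :: real
  assumes z: "2 \<le> z"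
  shows "(\<Sum>p | prime p \<and> real p \<le> z. 1 / real p) \<le> 4 * ln (ln (3 * z))"
proof -
  define j where "j = nat \<lfloor>log 2 z\<rfloor>"
  have "1 \<le> log 2 z" using z by simp
  then have j: "1 \<le> j" "real j \<le> log 2 z" "log 2 z < real (Suc j)" unfolding j_def by linarith+
  have lower: "2 ^ j \<le> z" using j z by (simp add: le_log_iff powr_realpow)
  have upper: "z < 2 ^ Suc j" using j(3) z by (simp add: log_less_iff powr_add powr_realpow)
  have "p \<le> 2 ^ Suc j" if "real p \<le> z" for p
    using that upper by (metis less_imp_le of_nat_le_iff of_nat_numeral of_nat_power order_trans)
  then have "(\<Sum>p | prime p \<and> real p \<le> z. 1 / real p) \<le> (\<Sum>p | prime p \<and> p \<le> 2 ^ Suc j. 1 / real p)"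
    by (intro sum_mono2 finite_primes_le) auto
  also have "\<dots> \<le> 4 * ln (ln (3 * 2 ^ j))" by (rule sum_inverse_primes_power_of_2_le[OF j(1)])
  also have "\<dots> \<le> 4 * ln (ln (3 * z))"
    using one_le_power[of "2::real" j] lower z
    by (intro mult_left_mono ln_mono ln_gt_zero) linarith+
  finally show ?thesis .
qed

lemma prod_one_plus_inverse_primes_le:
  fixes z c :: real
  assumes A: "A \<subseteq> {p. prime p \<and> real p \<le> z}" and z: "2 \<le> z" and c: "0 \<le> c"
  shows "(\<Prod>p\<in>A. 1 + c / real p) \<le> ln (3 * z) powr (4 * c)"
proof -
  have "(\<Prod>p\<in>A. 1 + c / real p) \<le> exp (\<Sum>p\<in>A. c / real p)"
    using c by (intro prod_le_exp_sum) simp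
  also have "\<dots> = exp (c * (\<Sum>p\<in>A. 1 / real p))" by (simp add: sum_distrib_left)
  also have "\<dots> \<le> exp (c * (\<Sum>p | prime p \<and> real p \<le> z. 1 / real p))"
    unfolding exp_le_cancel_iff using A c
    by (intro mult_left_mono sum_mono2 finite_primes_real_le) auto
  also have "\<dots> \<le> exp (c * (4 * ln (ln (3 * z))))"
    unfolding exp_le_cancel_iff using c by (intro mult_left_mono sum_inverse_primes_le z)
  also have "\<dots> = ln (3 * z) powr (4 * c)" using z by (simp add: powr_def mult_ac)
  finally show ?thesis .
qed

section \<open>The Legendre sieve on average\<close>

lemma sum_legendre_error_squared_le:
  assumes q: "squarefree q" and z: "2 \<le> z" "\<And>p. p \<in> prime_factors q \<Longrightarrow> real p \<le> z" and D: "0 < D"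
  shows "(\<Sum>n=1..N. (legendre_error D (gcd n q))\<^sup>2)
         \<le> real N * (exp (- ln D / ln z) * ln (3 * z) ^ 30)\<^sup>2"
proof -
  let ?x = "exp (- ln D / ln z)"
  have "(legendre_error D (gcd n q))\<^sup>2 \<le> ?x\<^sup>2 * (\<Prod>p\<in>prime_factors (gcd n q). 1 + 15)" for n
  proof -
    have "real p \<le> z" if "p \<in> prime_factors (gcd n q)" for p
      using that z(2) dvd_prime_factors[OF _ gcd_dvd2, of q n] squarefree_imp_pos_nat[OF q] by auto
    then have "\<bar>legendre_error D (gcd n q)\<bar> \<le> ?x * 4 ^ card (prime_factors (gcd n q))"
      using z(1) D squarefree_mono[OF gcd_dvd2 q] by (intro abs_legendre_error_le_power_card) auto
    then have "(legendre_error D (gcd n q))\<^sup>2 \<le> (?x * 4 ^ card (prime_factors (gcd n q)))\<^sup>2"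
      by (rule abs_le_square_iff[THEN iffD1, OF order_trans]) simp
    also have "\<dots> = ?x\<^sup>2 * (\<Prod>p\<in>prime_factors (gcd n q). 1 + 15)"
      by (simp add: power2_eq_square flip: power_mult_distrib)
    finally show ?thesis .
  qed
  then have "(\<Sum>n=1..N. (legendre_error D (gcd n q))\<^sup>2)
      \<le> ?x\<^sup>2 * (\<Sum>n=1..N. \<Prod>p\<in>prime_factors (gcd n q). 1 + 15)"
    unfolding sum_distrib_left by (intro sum_mono)
  also have "\<dots> \<le> ?x\<^sup>2 * (real N * (\<Prod>p\<in>prime_factors q. 1 + 15 / real p))"
    by (intro mult_left_mono sum_prod_prime_factors_gcd_le q) auto
  also have "\<dots> \<le> ?x\<^sup>2 * (real N * ln (3 * z) powr (4 * 15))"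
    using z by (intro mult_left_mono prod_one_plus_inverse_primes_le) auto
  also have "ln (3 * z) powr (4 * 15) = (ln (3 * z) ^ 30)\<^sup>2"
    using z(1) by (simp flip: power_mult)
  finally show ?thesis by (simp only: power_mult_distrib mult_ac)
qed

lemma norm_sum_mult_le_sqrt:
  fixes f g :: "'a \<Rightarrow> 'b :: real_normed_algebra"
  assumes "(\<Sum>i\<in>I. (norm (g i))\<^sup>2) \<le> c * t\<^sup>2" "0 \<le> t"
  shows "norm (\<Sum>i\<in>I. f i * g i) \<le> sqrt (c * (\<Sum>i\<in>I. (norm (f i))\<^sup>2)) * t"
proof -
  have "norm (\<Sum>i\<in>I. f i * g i) \<le> (\<Sum>i\<in>I. \<bar>norm (f i)\<bar> * \<bar>norm (g i)\<bar>)"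
    by (intro sum_norm_le) (simp add: norm_mult_ineq)
  also have "\<dots> \<le> L2_set (\<lambda>i. norm (f i)) I * L2_set (\<lambda>i. norm (g i)) I"
    by (rule L2_set_mult_ineq)
  also have "\<dots> \<le> sqrt (\<Sum>i\<in>I. (norm (f i))\<^sup>2) * sqrt (c * t\<^sup>2)"
    unfolding L2_set_def using assms(1) by (intro mult_left_mono) (auto intro: sum_nonneg)
  also have "\<dots> = sqrt (c * (\<Sum>i\<in>I. (norm (f i))\<^sup>2)) * t"
    using assms(2) by (simp add: real_sqrt_mult)
  finally show ?thesis .
qed

lemma norm_sum_legendre_error_le:
  fixes u :: "nat \<Rightarrow> 'a :: real_normed_field"
  assumes q: "squarefree q" "\<And>p. p \<in> prime_factors q \<Longrightarrow> real p \<le> z" and z: "2 \<le> z" and D: "0 < D"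
  shows "norm (\<Sum>n=1..N. u n * of_real (legendre_error D (gcd n q)))
    \<le> sqrt (real N * (\<Sum>n=1..N. (norm (u n))\<^sup>2)) * (exp (- ln D / ln z) * ln (3 * z) ^ 30)"
  using sum_legendre_error_squared_le[OF q(1) z q(2) D, of N] z
  by (intro norm_sum_mult_le_sqrt) auto

section \<open>The weights in Buchstab's identity\<close>

definition divisors_in :: "nat set \<Rightarrow> real set \<Rightarrow> nat \<Rightarrow> nat set" where
  "divisors_in P I n = {p \<in> P. real p \<in> I \<and> p dvd n}"

lemma finite_divisors_in: "0 < n \<Longrightarrow> finite (divisors_in P I n)"
  by (rule finite_subset[of _ "{d. d dvd n}"]) (auto simp: divisors_in_def)

lemma rho_eq_divisors_in:
  "rho P z Z m = of_bool (coprime m (prime_prod P z)) / (1 + real (card (divisors_in P {z..Z} m)))"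
  by (simp add: rho_def divisors_in_def conj_assoc)

definition buchstab_defect :: "nat set \<Rightarrow> real \<Rightarrow> real \<Rightarrow> nat \<Rightarrow> real" where
  "buchstab_defect P z Z n =
     of_bool (coprime n (prime_prod P z)) - of_bool (coprime n (prime_prod P Z))
     - (\<Sum>p\<in>divisors_in P {z..<Z} n. rho P z Z (n div p))"

lemma sum_perturbed_inverse_card_le:
  assumes "finite H" "G \<subseteq> H"
  shows "(\<Sum>p\<in>G. 1 / (real (card H) + of_bool (Q p))) \<le> of_bool (G \<noteq> {})"
proof -
  have G: "finite G" "card G \<le> card H" using assms by (auto intro: finite_subset card_mono)
  have "(\<Sum>p\<in>G. 1 / (real (card H) + of_bool (Q p))) \<le> (\<Sum>p\<in>G. 1 / real (card G))"
    using G by (intro sum_mono frac_le) (auto simp: card_gt_0_iff)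
  also have "\<dots> \<le> of_bool (G \<noteq> {})" using G by simp
  finally show ?thesis .
qed

lemma of_bool_le_sum_perturbed_inverse_card:
  assumes "finite H" "G \<subseteq> H" "card H \<le> Suc (card G)"
  shows "of_bool (G \<noteq> {}) \<le> (\<Sum>p\<in>G. 1 / (real (card H) + of_bool (Q p)))
           + ((\<Sum>p\<in>G. of_bool (Q p) / 2) + of_bool (G \<noteq> {} \<and> G \<noteq> H) / 2)"
proof (cases "G = {}")
  case False
  define w where "w = real (card H)"
  have "0 < card G" using False assms finite_subset by (auto simp: card_gt_0_iff)
  moreover have "card G \<le> card H" using assms by (intro card_mono)
  ultimately have w: "1 \<le> w" by (simp add: w_def)
  have "1 / w \<le> 1 / (w + of_bool (Q p)) + of_bool (Q p) / 2" for p
  proof -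
    have "1 / w - 1 / (w + 1) = 1 / (w * (w + 1))" using w by (simp add: field_simps)
    also have "\<dots> \<le> 1 / 2" using w mult_mono[of 1 w 2 "w + 1"] by (intro frac_le) auto
    finally show ?thesis by simp
  qed
  then have "(\<Sum>p\<in>G. 1 / w) \<le> (\<Sum>p\<in>G. 1 / (w + of_bool (Q p)) + of_bool (Q p) / 2)"
    by (intro sum_mono)
  then have "card G / w \<le> (\<Sum>p\<in>G. 1 / (w + of_bool (Q p))) + (\<Sum>p\<in>G. of_bool (Q p) / 2)"
    by (simp only: sum_constant sum.distrib times_divide_eq_right mult_1_right)
  moreover have "1 - card G / w \<le> of_bool (G \<noteq> H) / 2"
  proof (cases "G = H")
    case False
    then have "card G < card H" using assms by (intro psubset_card_mono) auto
    then have "w = card G + 1" using assms(3) by (simp add: w_def)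
    then show ?thesis using False \<open>0 < card G\<close> by (simp add: field_simps)
  qed (use w in \<open>simp add: w_def\<close>)
  ultimately show ?thesis using False by (simp add: w_def)
qed simp

context
  fixes P :: "nat set"
  assumes primes: "P \<subseteq> {p. prime p}"
begin

lemma squarefree_prime_prod: "squarefree (prime_prod P y)"
  unfolding prime_prod_def by (rule squarefree_prod_primes) (use primes in auto)

lemma prime_factors_prime_prod: "prime_factors (prime_prod P y) = {p \<in> P. real p < y}"
  unfolding prime_prod_def
proof (rule prime_factors_prod_primes)
  show "finite {p \<in> P. real p < y}"
    by (rule finite_subset[OF _ finite_primes_real_le[of y]]) (use primes in auto)
qed (use primes in auto)

lemma coprime_prime_prod_iff: "coprime n (prime_prod P y) \<longleftrightarrow> divisors_in P {..<y} n = {}"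
proof -
  let ?q = "prime_prod P y"
  have "coprime n ?q \<longleftrightarrow> (\<forall>p. p dvd ?q \<longrightarrow> prime p \<longrightarrow> \<not> p dvd n)"
  proof
    assume "coprime n ?q"
    then show "\<forall>p. p dvd ?q \<longrightarrow> prime p \<longrightarrow> \<not> p dvd n"
      using coprime_common_divisor not_prime_unit by blast
  next
    assume "\<forall>p. p dvd ?q \<longrightarrow> prime p \<longrightarrow> \<not> p dvd n"
    then have "gcd n ?q = 1" using prime_factor_nat[of "gcd n ?q"] by auto
    then show "coprime n ?q" by (simp add: coprime_iff_gcd_eq_1)
  qed
  also have "\<dots> \<longleftrightarrow> (\<forall>p\<in>prime_factors ?q. \<not> p dvd n)"
    using squarefree_imp_pos_nat[OF squarefree_prime_prod, of y]
    by (simp add: in_prime_factors_iff Ball_def imp_conjL)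
  finally show ?thesis by (auto simp: prime_factors_prime_prod divisors_in_def)
qed

lemma divisors_in_div:
  assumes "p \<in> P" "p dvd n"
  shows "divisors_in P I (n div p) = (if p\<^sup>2 dvd n then divisors_in P I n else divisors_in P I n - {p})"
proof -
  have n: "n = p * (n div p)" and p: "prime p" using assms primes by auto
  have square: "p\<^sup>2 dvd n \<longleftrightarrow> p dvd n div p"
    using p by (subst n) (simp add: power2_eq_square prime_gt_0_nat)
  have "r dvd n \<longleftrightarrow> r dvd n div p" if "r \<in> P" "r \<noteq> p" for r
  proof -
    have "prime r" using that primes by auto
    then show ?thesis
      using that p primes_dvd_imp_eq[of r p] by (subst n) (auto simp: prime_dvd_mult_iff)
  qed
  then show ?thesis using square assms by (auto simp: divisors_in_def)
qed

lemma rho_div: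
  assumes n: "0 < n" and p: "p \<in> divisors_in P {z..Z} n"
  shows "rho P z Z (n div p) = of_bool (coprime n (prime_prod P z))
           / (real (card (divisors_in P {z..Z} n)) + of_bool (p\<^sup>2 dvd n))"
proof -
  let ?H = "divisors_in P {z..Z}"
  have p_mem: "p \<in> P" "p dvd n" "p \<notin> divisors_in P {..<z} n" using p by (auto simp: divisors_in_def)
  have "coprime (n div p) (prime_prod P z) \<longleftrightarrow> coprime n (prime_prod P z)"
    using p_mem by (simp add: coprime_prime_prod_iff divisors_in_div)
  moreover have "1 + card (?H (n div p)) = card (?H n) + of_bool (p\<^sup>2 dvd n)"
    using p_mem p card_Suc_Diff1[OF finite_divisors_in[OF n] p] by (simp add: divisors_in_div)
  then have "1 + real (card (?H (n div p))) = real (card (?H n)) + of_bool (p\<^sup>2 dvd n)"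
    by (metis of_nat_1 of_nat_add of_nat_of_bool)
  ultimately show ?thesis by (simp add: rho_eq_divisors_in)
qed

lemma buchstab_defect_eq:
  assumes n: "0 < n" and zZ: "z \<le> Z"
  shows "buchstab_defect P z Z n = of_bool (coprime n (prime_prod P z))
           * (of_bool (divisors_in P {z..<Z} n \<noteq> {})
              - (\<Sum>p\<in>divisors_in P {z..<Z} n. 1 / (real (card (divisors_in P {z..Z} n)) + of_bool (p\<^sup>2 dvd n))))"
proof -
  have "divisors_in P {..<Z} n = divisors_in P {..<z} n \<union> divisors_in P {z..<Z} n"
    using zZ by (auto simp: divisors_in_def)
  then have "coprime n (prime_prod P Z) \<longleftrightarrow> coprime n (prime_prod P z) \<and> divisors_in P {z..<Z} n = {}"
    by (simp add: coprime_prime_prod_iff)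
  moreover have "rho P z Z (n div p) = of_bool (coprime n (prime_prod P z))
      * (1 / (real (card (divisors_in P {z..Z} n)) + of_bool (p\<^sup>2 dvd n)))"
    if "p \<in> divisors_in P {z..<Z} n" for p
    using that n by (subst rho_div) (auto simp: divisors_in_def)
  ultimately show ?thesis
    unfolding buchstab_defect_def by (simp add: sum_distrib_left right_diff_distrib)
qed

lemma buchstab_defect_bounds:
  assumes "0 < n" "z \<le> Z"
  shows "0 \<le> buchstab_defect P z Z n"
    and "buchstab_defect P z Z n \<le> 1"
proof -
  let ?G = "divisors_in P {z..<Z} n" and ?H = "divisors_in P {z..Z} n"
  let ?W = "\<Sum>p\<in>?G. 1 / (real (card ?H) + of_bool (p\<^sup>2 dvd n))"
  have "?W \<le> of_bool (?G \<noteq> {})"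
    using assms by (intro sum_perturbed_inverse_card_le finite_divisors_in) (auto simp: divisors_in_def)
  moreover have "0 \<le> ?W" by (intro sum_nonneg) simp
  ultimately show "0 \<le> buchstab_defect P z Z n" "buchstab_defect P z Z n \<le> 1"
    unfolding buchstab_defect_eq[OF assms] by (auto simp: of_bool_def split: if_splits)
qed

lemma buchstab_defect_le:
  assumes n: "n \<in> {1..N}" and zZ: "z \<le> Z"
  defines "a \<equiv> nat \<lceil>z\<rceil>" and "r \<equiv> nat \<lfloor>Z\<rfloor>"
  shows "buchstab_defect P z Z n \<le> (\<Sum>k=a..N. of_bool (k\<^sup>2 dvd n) / 2) + of_bool (a < r \<and> r dvd n) / 2"
proof -
  let ?G = "divisors_in P {z..<Z} n" and ?H = "divisors_in P {z..Z} n"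
  let ?R = "(\<Sum>p\<in>?G. of_bool (p\<^sup>2 dvd n) / 2) + of_bool (?G \<noteq> {} \<and> ?G \<noteq> ?H) / (2::real)"
  have fin: "finite ?G" "finite ?H" and sub: "?G \<subseteq> ?H"
    using n by (auto simp: divisors_in_def intro!: finite_divisors_in)
  have H_subset: "?H \<subseteq> insert r ?G"
    by (auto simp: divisors_in_def r_def less_le)
  have "card ?H \<le> Suc (card ?G)"
    using card_mono[OF _ H_subset] fin card_insert_if[of ?G r] by (auto split: if_splits)
  then have "buchstab_defect P z Z n \<le> ?R"
    using of_bool_le_sum_perturbed_inverse_card[OF fin(2) sub, of "\<lambda>p. p\<^sup>2 dvd n"] n
    by (subst buchstab_defect_eq[OF _ zZ]) (auto intro!: add_nonneg_nonneg sum_nonneg)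
  also have "?R \<le> (\<Sum>k=a..N. of_bool (k\<^sup>2 dvd n) / 2) + of_bool (a < r \<and> r dvd n) / 2"
  proof (intro add_mono)
    have "?G \<subseteq> {a..N}" using n by (auto simp: divisors_in_def a_def nat_le_iff ceiling_le_iff dest: dvd_imp_le)
    then show "(\<Sum>p\<in>?G. of_bool (p\<^sup>2 dvd n) / 2) \<le> (\<Sum>k=a..N. of_bool (k\<^sup>2 dvd n) / (2::real))"
      by (intro sum_mono2) auto
    have "a < r \<and> r dvd n" if "?G \<noteq> {}" "?G \<noteq> ?H"
    proof -
      have "r \<in> ?H" "r \<notin> ?G" using that sub H_subset by auto
      obtain p where "p \<in> ?G" using \<open>?G \<noteq> {}\<close> by auto
      have "real r = Z" using \<open>r \<in> ?H\<close> \<open>r \<notin> ?G\<close> by (auto simp: divisors_in_def)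
      then have "a < r" using \<open>p \<in> ?G\<close> by (auto simp: divisors_in_def a_def) linarith
      then show ?thesis using \<open>r \<in> ?H\<close> by (simp add: divisors_in_def)
    qed
    then show "of_bool (?G \<noteq> {} \<and> ?G \<noteq> ?H) / 2 \<le> of_bool (a < r \<and> r dvd n) / (2::real)"
      by auto
  qed
  finally show ?thesis .
qed

lemma sum_buchstab_defect_le:
  assumes z: "2 \<le> z" and zZ: "z \<le> Z"
  shows "(\<Sum>n=1..N. buchstab_defect P z Z n) \<le> real N / z"
proof -
  define a r where "a = nat \<lceil>z\<rceil>" and "r = nat \<lfloor>Z\<rfloor>"
  have a: "z \<le> real a" "2 \<le> real a" using z unfolding a_def by linarith+
  have sum_dvd_r: "(\<Sum>n=1..N. of_bool (a < r \<and> r dvd n)) \<le> real N / (real a + 1)"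
  proof (cases "a < r")
    case True
    then have "(\<Sum>n=1..N. of_bool (a < r \<and> r dvd n)) \<le> real N / real r"
      using sum_of_bool_dvd_le[of r N] by simp
    also have "\<dots> \<le> real N / (real a + 1)" using True by (intro divide_left_mono) auto
    finally show ?thesis .
  qed simp
  have "(\<Sum>n=1..N. buchstab_defect P z Z n)
      \<le> (\<Sum>n=1..N. (\<Sum>k=a..N. of_bool (k\<^sup>2 dvd n) / 2) + of_bool (a < r \<and> r dvd n) / 2)"
    unfolding a_def r_def by (intro sum_mono buchstab_defect_le zZ)
  also have "\<dots> = ((\<Sum>k=a..N. \<Sum>n=1..N. of_bool (k\<^sup>2 dvd n)) + (\<Sum>n=1..N. of_bool (a < r \<and> r dvd n))) / 2"
    by (subst sum.swap) (simp only: sum.distrib sum_divide_distrib add_divide_distrib)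
  also have "\<dots> \<le> (real N / (real a - 1 / 2) + real N / (real a + 1)) / 2"
    using a by (intro divide_right_mono add_mono sum_of_bool_square_dvd_le sum_dvd_r) auto
  also have "\<dots> = real N * ((4 * real a + 1) / ((2 * real a - 1) * (2 * real a + 2)))"
    using a by (simp add: field_simps)
  also have "\<dots> \<le> real N * (1 / real a)"
  proof (rule mult_left_mono)
    have "real a * (4 * real a + 1) \<le> (2 * real a - 1) * (2 * real a + 2)"
      using a by (simp add: algebra_simps)
    then show "(4 * real a + 1) / ((2 * real a - 1) * (2 * real a + 2)) \<le> 1 / real a"
      using a mult_pos_pos[of "2 * real a - 1" "2 * real a + 2"]
      by (simp add: divide_le_eq le_divide_eq mult.commute)
  qed simp
  also have "\<dots> \<le> real N / z" using a z by (simp add: divide_left_mono)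
  finally show ?thesis .
qed

lemma norm_sum_buchstab_defect_le:
  fixes u :: "nat \<Rightarrow> 'a :: real_normed_field"
  assumes z: "2 \<le> z" "z \<le> Z"
  shows "norm (\<Sum>n=1..N. u n * of_real (buchstab_defect P z Z n))
    \<le> sqrt (real N * (\<Sum>n=1..N. (norm (u n))\<^sup>2)) * (1 / sqrt z)"
proof (rule norm_sum_mult_le_sqrt)
  have "(\<Sum>n=1..N. (norm (of_real (buchstab_defect P z Z n) :: 'a))\<^sup>2)
      \<le> (\<Sum>n=1..N. buchstab_defect P z Z n)"
    using buchstab_defect_bounds[OF _ z(2)]
    by (intro sum_mono) (auto simp: power2_eq_square mult_left_le)
  also have "\<dots> \<le> real N / z" by (rule sum_buchstab_defect_le[OF z])
  also have "\<dots> = real N * (1 / sqrt z)\<^sup>2" using z by (simp add: power_divide)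
  finally show "(\<Sum>n=1..N. (norm (of_real (buchstab_defect P z Z n) :: 'a))\<^sup>2)
      \<le> real N * (1 / sqrt z)\<^sup>2" .
qed (use z in simp)

lemma norm_sum_buchstab_defect_le_of_bounded:
  fixes u :: "nat \<Rightarrow> 'a :: real_normed_field"
  assumes z: "2 \<le> z" "z \<le> Z"
    and u: "\<And>n. n \<in> {1..N} \<Longrightarrow> norm (u n) \<le> 1"
  shows "norm (\<Sum>n=1..N. u n * of_real (buchstab_defect P z Z n)) \<le> real N / z"
proof -
  have "norm (\<Sum>n=1..N. u n * of_real (buchstab_defect P z Z n)) \<le> (\<Sum>n=1..N. buchstab_defect P z Z n)"
    using buchstab_defect_bounds[OF _ z(2)] u
    by (intro sum_norm_le) (auto simp: norm_mult mult_left_le_one_le)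
  also have "\<dots> \<le> real N / z" by (rule sum_buchstab_defect_le[OF z])
  finally show ?thesis .
qed

section \<open>Decomposition of the sifted sum\<close>

lemma sum_rho_pairs_eq:
  fixes u :: "nat \<Rightarrow> 'a :: real_normed_field"
  shows "(\<Sum>(m, p) | 1 \<le> m \<and> p \<in> P \<and> z \<le> real p \<and> real p < Z \<and> m * p \<le> N.
            of_real (rho P z Z m) * u (m * p))
    = (\<Sum>n=1..N. u n * of_real (\<Sum>p\<in>divisors_in P {z..<Z} n. rho P z Z (n div p)))"
proof -
  have "0 \<notin> P" using primes by auto
  then have "(\<Sum>(m, p) | 1 \<le> m \<and> p \<in> P \<and> z \<le> real p \<and> real p < Z \<and> m * p \<le> N.
            of_real (rho P z Z m) * u (m * p))
      = (\<Sum>n=1..N. \<Sum>p\<in>divisors_in P {z..<Z} n. of_real (rho P z Z (n div p)) * u (n div p * p))"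
    using sum_pairs_mult_le[of "{p \<in> P. real p \<in> {z..<Z}}" "\<lambda>m p. of_real (rho P z Z m) * u (m * p)" N]
    by (simp add: divisors_in_def conj_assoc)
  also have "\<dots> = (\<Sum>n=1..N. u n * of_real (\<Sum>p\<in>divisors_in P {z..<Z} n. rho P z Z (n div p)))"
    unfolding of_real_sum sum_distrib_left
    by (intro sum.cong) (auto simp: divisors_in_def)
  finally show ?thesis .
qed

lemma sum_coprime_prime_prod_eq:
  fixes u :: "nat \<Rightarrow> 'a :: real_normed_field"
  shows "(\<Sum>n | n \<in> {1..N} \<and> coprime n (prime_prod P Z). u n) =
        (\<Sum>d | d dvd prime_prod P z \<and> real d \<le> D.
            of_int (moebius_mu d) * (\<Sum>n | n \<in> {1..N} \<and> d dvd n. u n))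
        - (\<Sum>(m, p) | 1 \<le> m \<and> p \<in> P \<and> z \<le> real p \<and> real p < Z \<and> m * p \<le> N.
            of_real (rho P z Z m) * u (m * p))
        + ((\<Sum>n=1..N. u n * of_real (legendre_error D (gcd n (prime_prod P z))))
           - (\<Sum>n=1..N. u n * of_real (buchstab_defect P z Z n)))"
proof -
  define q where "q = prime_prod P z"
  have "(\<Sum>n | n \<in> {1..N} \<and> coprime n (prime_prod P Z). u n)
      = (\<Sum>n=1..N. u n * of_real (of_bool (coprime n (prime_prod P Z))))"
    by (subst sum.inter_filter) (auto simp: of_bool_def intro: sum.cong)
  also have "\<dots> = (\<Sum>n=1..N. u n * of_real (of_bool (coprime n q) - legendre_error D (gcd n q)
      - (\<Sum>p\<in>divisors_in P {z..<Z} n. rho P z Z (n div p))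
      + (legendre_error D (gcd n q) - buchstab_defect P z Z n)))"
    by (simp add: buchstab_defect_def q_def)
  also have "\<dots> = (\<Sum>n=1..N. u n * of_real (of_bool (coprime n q) - legendre_error D (gcd n q)))
      - (\<Sum>n=1..N. u n * of_real (\<Sum>p\<in>divisors_in P {z..<Z} n. rho P z Z (n div p)))
      + ((\<Sum>n=1..N. u n * of_real (legendre_error D (gcd n q)))
         - (\<Sum>n=1..N. u n * of_real (buchstab_defect P z Z n)))"
    by (simp only: of_real_add of_real_diff distrib_left right_diff_distrib sum.distrib sum_subtractf)
  finally show ?thesis
    unfolding sum_rho_pairs_eq q_def sum_moebius_multiples[OF squarefree_prime_prod] .
qed

end

lemma ex_unit_ball_factor:
  fixes s t x :: "'a :: real_normed_field"
  assumes "s = t + x" "norm x \<le> E"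
  shows "\<exists>\<theta>::'a. norm \<theta> \<le> 1 \<and> s = t + \<theta> * of_real E"
proof (cases "E = 0")
  case False
  then have "0 < E" using assms(2) norm_ge_zero[of x] by linarith
  then show ?thesis
    using assms by (intro exI[of _ "x / of_real E"]) (simp add: norm_divide)
qed (use assms in \<open>auto intro: exI[of _ 0]\<close>)

theorem theorem1p1:
  fixes P :: "nat set" and \<kappa> :: real
  assumes "infinite P" and "\<And>p. p \<in> P \<Longrightarrow> prime p"
    and "0 < \<kappa>" and "\<kappa> \<le> 1" and "has_log_density P \<kappa>"
  shows "\<exists>N0::nat. \<forall>N\<ge>N0. \<forall>(z::real) (D::real) (Z::real) (u :: nat \<Rightarrow> complex).
    2 \<le> z \<and> z \<le> D \<and> D \<le> sqrt (real N) \<and> z \<le> Z \<longrightarrow>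
    (\<exists>\<theta>::complex. norm \<theta> \<le> 1 \<and>
      (\<Sum>n | n \<in> {1..N} \<and> coprime n (prime_prod P Z). u n) =
        (\<Sum>d | d dvd prime_prod P z \<and> real d \<le> D.
            of_int (moebius_mu d) * (\<Sum>n | n \<in> {1..N} \<and> d dvd n. u n))
        - (\<Sum>(m, p) | 1 \<le> m \<and> p \<in> P \<and> z \<le> real p \<and> real p < Z \<and> m * p \<le> N.
            of_real (rho P z Z m) * u (m * p))
        + \<theta> * of_real
            (sqrt (real N * (\<Sum>n\<in>{1..N}. (norm (u n))\<^sup>2)) *
              (1 / sqrt z + exp (- ln D / ln z) * ln (3 * z) ^ 31))) \<and>
    ((\<forall>n\<in>{1..N}. norm (u n) \<le> 1) \<longrightarrow>
      (\<exists>\<theta>::complex. norm \<theta> \<le> 1 \<and>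
      (\<Sum>n | n \<in> {1..N} \<and> coprime n (prime_prod P Z). u n) =
        (\<Sum>d | d dvd prime_prod P z \<and> real d \<le> D.
            of_int (moebius_mu d) * (\<Sum>n | n \<in> {1..N} \<and> d dvd n. u n))
        - (\<Sum>(m, p) | 1 \<le> m \<and> p \<in> P \<and> z \<le> real p \<and> real p < Z \<and> m * p \<le> N.
            of_real (rho P z Z m) * u (m * p))
        + \<theta> * of_real
            (real N / z +
              sqrt (real N * (\<Sum>n\<in>{1..N}. (norm (u n))\<^sup>2)) *
                (exp (- ln D / ln z) * ln (3 * z) ^ 31))))"
proof (intro exI[of _ 0] allI impI, goal_cases)
  case (1 N z D Z u)
  then have z: "2 \<le> z" "z \<le> Z" and D: "0 < D" by auto
  have primes: "P \<subseteq> {p. prime p}" using assms(2) by auto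
  let ?legendre = "\<Sum>n=1..N. u n * of_real (legendre_error D (gcd n (prime_prod P z)))"
  let ?buchstab = "\<Sum>n=1..N. u n * of_real (buchstab_defect P z Z n)"
  let ?norm_u = "sqrt (real N * (\<Sum>n\<in>{1..N}. (norm (u n))\<^sup>2))"
  let ?t = "exp (- ln D / ln z) * ln (3 * z) ^ 31"
  have "1 \<le> ln (3 * z)" using z exp_le by (simp add: ln_ge_iff)
  have "norm ?legendre \<le> ?norm_u * (exp (- ln D / ln z) * ln (3 * z) ^ 30)"
    using z D by (intro norm_sum_legendre_error_le squarefree_prime_prod)
      (auto simp: primes prime_factors_prime_prod[OF primes])
  also have "\<dots> \<le> ?norm_u * ?t"
    using \<open>1 \<le> ln (3 * z)\<close> by (intro mult_left_mono power_increasing) (simp_all add: sum_nonneg)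
  finally have legendre: "norm ?legendre \<le> ?norm_u * ?t" .
  have "norm (?legendre - ?buchstab) \<le> ?norm_u * (1 / sqrt z + ?t)"
    unfolding distrib_left using legendre norm_sum_buchstab_defect_le[OF primes z, where u = u and N = N]
    by (intro order_trans[OF norm_triangle_ineq4]) linarith
  moreover have "norm (?legendre - ?buchstab) \<le> real N / z + ?norm_u * ?t" if "\<forall>n\<in>{1..N}. norm (u n) \<le> 1"
    using legendre norm_sum_buchstab_defect_le_of_bounded[OF primes z, where u = u and N = N] that
    by (intro order_trans[OF norm_triangle_ineq4]) force
  ultimately show ?case
    by (intro conjI impI ex_unit_ball_factor[OF sum_coprime_prime_prod_eq[OF primes]])
qed

end
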